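(* Let $\mathbf{L}\in\mathbb{R}^{N\times N}$ be the graph Laplacian of the power network, $\mathbf{H}\in\mathbb{R}^{M\times N}$ the measurement matrix, $\mathcal{S}\subseteq\{1,\dots,M\}$ the set of indices of protected measurements, $\mathbf{H}^{\mathcal{S}}$ the submatrix of $\mathbf{H}$ formed by the rows with indices in $\mathcal{S}$, $k\in\mathbb{R}_+$ a sparsity parameter and $\tau>0$ an impact threshold (all as defined in the context). Consider the GFDI attack optimization problem $$\text{(P)}\qquad \min_{\mathbf{c}\in\mathbb{R}^N}\ \mathbf{c}^T\mathbf{L}\mathbf{c}\quad\text{s.t.}\quad \|\mathbf{c}\|_\infty\ge\tau,\quad \|\mathbf{c}\|_0\le k,\quad \mathbf{H}^{\mathcal{S}}\mathbf{c}=\mathbf{0},$$ and the series of optimization problems $$\text{(Q)}\qquad \min_{i\in\{1,\dots,N\}}\ \min_{\mathbf{c}\in\mathbb{R}^N}\ \mathbf{c}^T\mathbf{L}\mathbf{c}\quad\text{s.t.}\quad c_i=\tau,\quad \|\mathbf{c}\|_0\le k,\quad \mathbf{H}^{\mathcal{S}}\mathbf{c}=\mathbf{0}.$$ Then the solution of (P) can be obtained by solving (Q), in the following sense: if (P) has an optimal solution, then (Q) has an optimal solution, and every optimal solution $\mathbf{c}$ of (Q) is an optimal solution of (P).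
   Context: The power network is represented by a connected, undirected weighted graph $\mathcal{G}(\mathcal{V},\xi)$ with node set $\mathcal{V}=\{1,\dots,N\}$ (the buses) and edge set $\xi$ (the transmission lines). Each line $(m,n)\in\xi$ has a susceptance $b_{m,n}=b_{n,m}<0$. The set of buses connected to bus $m$ is denoted $\mathcal{N}_m$. Graph Laplacian: with edge weights $\omega_{m,n}=-b_{m,n}>0$ for $(m,n)\in\xi$, the matrix $\mathbf{L}\in\mathbb{R}^{N\times N}$ has entries $L_{m,m}=\sum_{n\in\mathcal{N}_m}\omega_{m,n}$, $L_{m,n}=-\omega_{m,n}$ if $(m,n)\in\xi$, and $L_{m,n}=0$ otherwise. Measurement matrix: $\mathbf{H}\in\mathbb{R}^{M\times N}$ has one row per sensor measurement. A row $r$ associated with the power flow measurement on a line $(m,n)\in\xi$ has entries $H_{r,m}=b_{m,n}$, $H_{r,n}=-b_{m,n}$ and $H_{r,j}=0$ otherwise. A row $r$ associated with the power injection measurement at bus $m$ has entries $H_{r,m}=\sum_{n\in\mathcal{N}_m}b_{m,n}$, $H_{r,j}=-b_{m,j}$ for $j\in\mathcal{N}_m$, and $H_{r,j}=0$ otherwise. Norms: $\|\mathbf{c}\|_\infty=\max_n|c_n|$, and $\|\mathbf{c}\|_0$ is the number of nonzero entries of $\mathbf{c}$. Convention for (Q): an inner problem (for a given $i$) with no feasible point is disregarded (its value is $+\infty$). A feasible point of (Q) is a vector $\mathbf{c}\in\mathbb{R}^N$ satisfying the constraints of the inner problem for at least one $i\in\{1,\dots,N\}$. An optimal solution of (Q)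 is a feasible point of (Q) that attains the minimum of $\mathbf{c}^T\mathbf{L}\mathbf{c}$ over all feasible points of (Q). *)

theory Defs
  imports "HOL-Analysis.Analysis"
begin

text \<open>
  Buses are the elements of a finite type \<open>'n\<close>. A set of lines is stored as a symmetric
  irreflexive relation, so each line occurs with both orientations. Values of \<open>b\<close> off the lines
  are unconstrained and never used.
\<close>

definition power_network :: "('n::finite \<times> 'n) set \<Rightarrow> ('n \<Rightarrow> 'n \<Rightarrow> real) \<Rightarrow> bool" where
  "power_network \<xi> b \<longleftrightarrow>
     sym \<xi> \<and> irrefl \<xi> \<and> (\<forall>m n. (m, n) \<in> \<xi>\<^sup>*) \<and>
     (\<forall>(m, n) \<in> \<xi>. b m n = b n m \<and> b m n < 0)"

definition neighbours :: "('n::finite \<times> 'n) set \<Rightarrow> 'n \<Rightarrow> 'n set" where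
  "neighbours \<xi> m = {n. (m, n) \<in> \<xi>}"

definition edge_weight :: "('n \<Rightarrow> 'n \<Rightarrow> real) \<Rightarrow> 'n \<Rightarrow> 'n \<Rightarrow> real" where
  "edge_weight b m n = - b m n"

definition laplacian :: "('n::finite \<times> 'n) set \<Rightarrow> ('n \<Rightarrow> 'n \<Rightarrow> real) \<Rightarrow> real^'n^'n" where
  "laplacian \<xi> b = (\<chi> m n.
     if m = n then \<Sum>p\<in>neighbours \<xi> m. edge_weight b m p
     else if (m, n) \<in> \<xi> then - edge_weight b m n
     else 0)"

datatype 'n measurement = Flow 'n 'n | Injection 'n

text \<open>A flow can only be measured on an existing line, in either orientation.\<close>

fun valid_measurement :: "('n::finite \<times> 'n) set \<Rightarrow> 'n measurement \<Rightarrow> bool" where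
  "valid_measurement \<xi> (Flow m n) \<longleftrightarrow> (m, n) \<in> \<xi>"
| "valid_measurement \<xi> (Injection m) \<longleftrightarrow> True"

fun measurement_entry ::
    "('n::finite \<times> 'n) set \<Rightarrow> ('n \<Rightarrow> 'n \<Rightarrow> real) \<Rightarrow> 'n measurement \<Rightarrow> 'n \<Rightarrow> real" where
  "measurement_entry \<xi> b (Flow m n) j =
     (if j = m then b m n else if j = n then - b m n else 0)"
| "measurement_entry \<xi> b (Injection m) j =
     (if j = m then \<Sum>n\<in>neighbours \<xi> m. b m n
      else if j \<in> neighbours \<xi> m then - b m j
      else 0)"

definition measurement_matrix ::
    "('n::finite \<times> 'n) set \<Rightarrow> ('n \<Rightarrow> 'n \<Rightarrow> real) \<Rightarrow> ('m::finite \<Rightarrow> 'n measurement) \<Rightarrow> real^'n^'m" where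
  "measurement_matrix \<xi> b meas = (\<chi> r j. measurement_entry \<xi> b (meas r) j)"

definition l0_norm :: "real^'n::finite \<Rightarrow> nat" where
  "l0_norm c = card {n. c $ n \<noteq> 0}"

text \<open>
  The equation \<open>H\<^sup>S c = 0\<close> for the submatrix of the rows of \<open>H\<close> with index in \<open>S\<close>, written
  out row by row.
\<close>

definition rows_annihilate :: "real^'n::finite^'m::finite \<Rightarrow> 'm set \<Rightarrow> real^'n \<Rightarrow> bool" where
  "rows_annihilate H S c \<longleftrightarrow> (\<forall>r\<in>S. (H *v c) $ r = 0)"

definition P_feasible ::
    "real^'n::finite^'m::finite \<Rightarrow> 'm set \<Rightarrow> real \<Rightarrow> real \<Rightarrow> real^'n \<Rightarrow> bool" where
  "P_feasible H S k \<tau> c \<longleftrightarrow>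
     infnorm c \<ge> \<tau> \<and> real (l0_norm c) \<le> k \<and> rows_annihilate H S c"

definition Q_inner_feasible ::
    "real^'n::finite^'m::finite \<Rightarrow> 'm set \<Rightarrow> real \<Rightarrow> real \<Rightarrow> 'n \<Rightarrow> real^'n \<Rightarrow> bool" where
  "Q_inner_feasible H S k \<tau> i c \<longleftrightarrow>
     c $ i = \<tau> \<and> real (l0_norm c) \<le> k \<and> rows_annihilate H S c"

definition Q_feasible ::
    "real^'n::finite^'m::finite \<Rightarrow> 'm set \<Rightarrow> real \<Rightarrow> real \<Rightarrow> real^'n \<Rightarrow> bool" where
  "Q_feasible H S k \<tau> c \<longleftrightarrow> (\<exists>i. Q_inner_feasible H S k \<tau> i c)"

definition P_optimal ::
    "real^'n^'n \<Rightarrow> real^'n::finite^'m::finite \<Rightarrow> 'm set \<Rightarrow> real \<Rightarrow> real \<Rightarrow> real^'n \<Rightarrow> bool" where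
  "P_optimal L H S k \<tau> c \<longleftrightarrow> is_arg_min (\<lambda>x. x \<bullet> (L *v x)) (P_feasible H S k \<tau>) c"

definition Q_optimal ::
    "real^'n^'n \<Rightarrow> real^'n::finite^'m::finite \<Rightarrow> 'm set \<Rightarrow> real \<Rightarrow> real \<Rightarrow> real^'n \<Rightarrow> bool" where
  "Q_optimal L H S k \<tau> c \<longleftrightarrow> is_arg_min (\<lambda>x. x \<bullet> (L *v x)) (Q_feasible H S k \<tau>) c"

end

theory Submission
  imports Defs
begin

text \<open>
  The Laplacian form is a weighted sum of squares of differences along the lines, hence
  nonnegative and homogeneous of degree two. Scaling a feasible point of (P) by
  \<open>\<tau> / c\<^sub>i\<close>, where \<open>\<bar>c\<^sub>i\<bar> = \<parallel>c\<parallel>\<^sub>\<infinity> \<ge> \<tau>\<close>, yields a feasible point of (Q)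
  without increasing the objective. Since the feasible points of (Q) are feasible for (P), both
  problems have the same optimal value.
\<close>

lemma laplacian_mult_nth:
  assumes "irrefl \<xi>"
  shows "(laplacian \<xi> b *v x) $ m = (\<Sum>n\<in>neighbours \<xi> m. edge_weight b m n * (x $ m - x $ n))"
proof -
  have m: "m \<notin> neighbours \<xi> m"
    using assms by (auto simp: neighbours_def irrefl_def)
  \<comment> \<open>Since \<open>m\<close> is not its own neighbour, the two conditionals never
    apply to the same \<open>n\<close>, so the diagonal and off-diagonal terms can be summed
    separately.\<close>
  have "(laplacian \<xi> b *v x) $ m =
      (\<Sum>n\<in>UNIV. (if n = m then (\<Sum>p\<in>neighbours \<xi> m. edge_weight b m p) * x $ m else 0)
        + (if n \<in> neighbours \<xi> m then - edge_weight b m n * x $ n else 0))"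
    unfolding matrix_vector_mult_def vec_lambda_beta
    by (intro sum.cong refl) (use m in \<open>auto simp: laplacian_def neighbours_def\<close>)
  also have "\<dots> = (\<Sum>p\<in>neighbours \<xi> m. edge_weight b m p) * x $ m
      + (\<Sum>n\<in>neighbours \<xi> m. - edge_weight b m n * x $ n)"
    by (simp add: sum.distrib flip: sum.inter_filter)
  also have "\<dots> = (\<Sum>n\<in>neighbours \<xi> m. edge_weight b m n * (x $ m - x $ n))"
    by (simp add: sum_distrib_right right_diff_distrib sum_subtractf sum_negf)
  finally show ?thesis .
qed

lemma laplacian_form_nonneg:
  assumes "power_network \<xi> b"
  shows "0 \<le> x \<bullet> (laplacian \<xi> b *v x)"
proof -
  have sym: "sym \<xi>" and irrefl: "irrefl \<xi>"
    and b: "\<And>m n. (m, n) \<in> \<xi> \<Longrightarrow> b m n = b n m \<and> b m n < 0"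
    using assms by (auto simp: power_network_def)
  define f where "f = (\<lambda>(m, n). edge_weight b m n * x $ m * (x $ m - x $ n))"
  have form: "x \<bullet> (laplacian \<xi> b *v x) = sum f \<xi>"
  proof -
    have "x \<bullet> (laplacian \<xi> b *v x) = (\<Sum>m\<in>UNIV. \<Sum>n\<in>neighbours \<xi> m. f (m, n))"
      by (simp add: inner_vec_def laplacian_mult_nth[OF irrefl] f_def sum_distrib_left mult_ac)
    also have "\<dots> = sum f (SIGMA m:UNIV. neighbours \<xi> m)"
      by (simp add: sum.Sigma)
    also have "(SIGMA m:UNIV. neighbours \<xi> m) = \<xi>"
      by (auto simp: neighbours_def)
    finally show ?thesis .
  qed
  \<comment> \<open>Symmetrisation: \<open>\<xi>\<close> contains both orientations of every line,
    and adding \<open>x $ m * (x $ m - x $ n)\<close> to its reversed copy, with equal weights,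
    completes the square. Hence the factor 2 below.\<close>
  have "sum f \<xi> = (\<Sum>p\<in>\<xi>. f (prod.swap p))"
    by (rule sum.reindex_bij_witness[of _ prod.swap prod.swap]) (use sym in \<open>auto dest: symD\<close>)
  then have "2 * sum f \<xi> = (\<Sum>p\<in>\<xi>. f p + f (prod.swap p))"
    by (simp add: sum.distrib)
  also have "\<dots> = (\<Sum>(m, n)\<in>\<xi>. edge_weight b m n * (x $ m - x $ n)\<^sup>2)"
    by (intro sum.cong refl)
      (auto simp: f_def edge_weight_def power2_eq_square algebra_simps dest: b)
  also have "\<dots> \<ge> 0"
    by (intro sum_nonneg) (auto simp: edge_weight_def mult_nonpos_nonneg less_imp_le dest: b)
  finally show ?thesis
    by (simp add: form)
qed

lemma l0_norm_scaleR:
  assumes "s \<noteq> 0"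
  shows "l0_norm (s *\<^sub>R c) = l0_norm c"
  using assms by (simp add: l0_norm_def)

lemma rows_annihilate_scaleR:
  assumes "rows_annihilate H S c"
  shows "rows_annihilate H S (s *\<^sub>R c)"
  using assms by (simp add: rows_annihilate_def matrix_vector_mult_scaleR)

text \<open>The index type is finite, so the supremum behind \<open>infnorm\<close> is a maximum.
  The coordinate obtained here is the one that gets fixed to \<open>\<tau>\<close> in (Q).\<close>

lemma infnorm_attained:
  fixes c :: "real^'n"
  obtains i where "\<bar>c $ i\<bar> = infnorm c"
proof -
  have eq: "infnorm c = Max (range (\<lambda>i. \<bar>c $ i\<bar>))"
    by (simp add: infnorm_cart cSup_eq_Max full_SetCompr_eq)
  have "infnorm c \<in> range (\<lambda>i. \<bar>c $ i\<bar>)"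
    unfolding eq by (rule Max_in) auto
  then show thesis
    using that by auto
qed

text \<open>Only the norm bound needs an argument:
  \<open>\<tau> = c $ i \<le> \<bar>c $ i\<bar> \<le> infnorm c\<close>.\<close>

lemma Q_feasible_imp_P_feasible:
  assumes "Q_feasible H S k \<tau> c"
  shows "P_feasible H S k \<tau> c"
  using assms order_trans[OF abs_ge_self component_le_infnorm_cart]
  unfolding Q_feasible_def Q_inner_feasible_def P_feasible_def by blast

text \<open>The factor may be negative: if the extreme coordinate is below zero, the scaling also
  flips the sign, which a quadratic form does not see. This is why only \<open>\<bar>s\<bar>\<close>
  is bounded.\<close>

lemma P_feasible_scaled_Q_feasible:
  assumes "P_feasible H S k \<tau> c" and "\<tau> > 0"
  obtains s where "\<bar>s\<bar> \<le> 1" and "Q_feasible H S k \<tau> (s *\<^sub>R c)"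
proof -
  obtain i where i: "\<bar>c $ i\<bar> = infnorm c"
    by (rule infnorm_attained)
  with assms have ge: "\<tau> \<le> \<bar>c $ i\<bar>"
    by (simp add: P_feasible_def)
  with assms have nz: "c $ i \<noteq> 0"
    by auto
  show thesis
  proof
    show "\<bar>\<tau> / c $ i\<bar> \<le> 1"
      using ge nz assms by (simp add: abs_divide)
    \<comment> \<open>As \<open>\<tau> > 0\<close>, the factor is nonzero and the support of
      \<open>c\<close> is unchanged.\<close>
    show "Q_feasible H S k \<tau> ((\<tau> / c $ i) *\<^sub>R c)"
      unfolding Q_feasible_def Q_inner_feasible_def
      using assms nz
      by (intro exI[of _ i]) (simp add: P_feasible_def l0_norm_scaleR rows_annihilate_scaleR)
  qed
qed

text \<open>Scaling multiplies the form by \<open>s\<^sup>2\<close>, which is at most 1;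
  nonnegativity ensures that this cannot raise the value.\<close>

lemma form_scaleR_le:
  fixes L :: "real^'n^'n"
  assumes "0 \<le> c \<bullet> (L *v c)" and "\<bar>s\<bar> \<le> 1"
  shows "(s *\<^sub>R c) \<bullet> (L *v (s *\<^sub>R c)) \<le> c \<bullet> (L *v c)"
proof -
  have "s\<^sup>2 \<le> 1"
    using assms(2) by (simp add: abs_square_le_1)
  then have "s\<^sup>2 * (c \<bullet> (L *v c)) \<le> c \<bullet> (L *v c)"
    using assms(1) by (rule mult_left_le_one_le[OF _ zero_le_power2, rotated])
  then show ?thesis
    by (simp add: matrix_vector_mult_scaleR power2_eq_square mult.assoc)
qed

theorem theorem1:
  fixes \<xi> :: "('n::finite \<times> 'n) set"
    and b :: "'n \<Rightarrow> 'n \<Rightarrow> real"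
    and meas :: "'m::finite \<Rightarrow> 'n measurement"
    and S :: "'m set"
    and k \<tau> :: real
    and L :: "real^'n^'n"
    and H :: "real^'n^'m"
  assumes "power_network \<xi> b"
    and "\<forall>r. valid_measurement \<xi> (meas r)"
    and "L = laplacian \<xi> b"
    and "H = measurement_matrix \<xi> b meas"
    and "k \<ge> 0"
    and "\<tau> > 0"
  shows "(\<exists>c. P_optimal L H S k \<tau> c) \<longrightarrow>
           (\<exists>c. Q_optimal L H S k \<tau> c) \<and>
           (\<forall>c. Q_optimal L H S k \<tau> c \<longrightarrow> P_optimal L H S k \<tau> c)"
proof (intro impI)
  let ?f = "\<lambda>x. x \<bullet> (L *v x)"
  assume "\<exists>c. P_optimal L H S k \<tau> c"
  then obtain c where c: "P_feasible H S k \<tau> c"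
    and c_min: "\<And>y. P_feasible H S k \<tau> y \<Longrightarrow> ?f c \<le> ?f y"
    by (auto simp: P_optimal_def is_arg_min_linorder)
  obtain s where s: "\<bar>s\<bar> \<le> 1" and Q: "Q_feasible H S k \<tau> (s *\<^sub>R c)"
    using c \<open>\<tau> > 0\<close> by (rule P_feasible_scaled_Q_feasible)
  have le: "?f (s *\<^sub>R c) \<le> ?f c"
    using laplacian_form_nonneg[OF assms(1)] s by (intro form_scaleR_le) (simp_all add: assms(3))
  \<comment> \<open>Every competitor in (Q) is feasible for (P), so its value is at least
    \<open>?f c\<close>, a bound that the scaled point already meets.\<close>
  have "Q_optimal L H S k \<tau> (s *\<^sub>R c)"
    unfolding Q_optimal_def is_arg_min_linorder
    using Q le c_min Q_feasible_imp_P_feasible order_trans by blast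
  moreover have "P_optimal L H S k \<tau> d" if "Q_optimal L H S k \<tau> d" for d
  proof -
    \<comment> \<open>Comparison with the scaled point puts \<open>?f d\<close> below the optimal
      value \<open>?f c\<close> of (P) or equal to it, and \<open>d\<close> is itself feasible for
      (P).\<close>
    have d: "Q_feasible H S k \<tau> d" and "?f d \<le> ?f (s *\<^sub>R c)"
      using that Q by (auto simp: Q_optimal_def is_arg_min_linorder)
    then have "?f d \<le> ?f c"
      using le by linarith
    then show ?thesis
      unfolding P_optimal_def is_arg_min_linorder
      using Q_feasible_imp_P_feasible[OF d] c_min order_trans by blast
  qed
  ultimately show "(\<exists>c. Q_optimal L H S k \<tau> c) \<and>
      (\<forall>c. Q_optimal L H S k \<tau> c \<longrightarrow> P_optimal L H S k \<tau> c)"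
    by blast
qed

end
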